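(* All strong solutions are extreme; that is, $\mathcal{P}_\mu^{\mathrm{strong}}\subseteq\mathcal{P}_\mu^{\mathrm{ex}}$.
   Context: $\mathbb{N}=\{1,2,\dots\}$. Let $(G_k)_{k\in\mathbb{N}}$ be a sequence of compact Hausdorff groups with countable bases, let $\phi_k:G_{k+1}\to G_k$ be a continuous homomorphism for each $k$, and let $G:=\prod_{k\in\mathbb{N}}G_k$ with the product topology. Let $\mu=(\mu_k)_{k\in\mathbb{N}}$, where $\mu_k$ is a Borel probability measure on $G_k$. Let $X_k:G\to G_k$ be the $k$-th coordinate map and $Z_k:=\phi_k(X_{k+1})^{-1}X_k$. The set $\mathcal{P}_\mu$ of solutions of the stochastic equation associated with $\mu$ is the set of Borel probability measures $\mathbb{P}$ on $G$ such that for every $k\in\mathbb{N}$ and every bounded Borel $f:G_k\to\mathbb{R}$, the conditional expectation of $f(X_k)$ given $(X_j)_{j>k}$ under $\mathbb{P}$ equals $\int_{G_k}f(\phi_k(X_{k+1})z)\,\mu_k(dz)$ $\mathbb{P}$-a.s.; equivalently, for every $k$, under $\mathbb{P}$ the variable $Z_k$ has distribution $\mu_k$ and is independent of $(X_j)_{j>k}$. The set $\mathcal{P}_\mu$ is convex, and $\mathcal{P}_\mu^{\mathrm{ex}}$ denotes its set of extreme points. A solution $\mathbb{P}\in\mathcal{P}_\mu$ is strong if for each $k\in\mathbb{N}$ the variable $X_k$ is measurable, up to $\mathbb{P}$-null sets, with respect to $\sigma((Z_j)_{j\ge k})$; $\mathcal{P}_\mu^{\mathrm{strong}}$ denotes the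 set of strong solutions. *)

theory Defs
  imports "HOL-Probability.Probability" "HOL-Algebra.Group"
begin

definition borel_of :: "'a topology \<Rightarrow> 'a measure" where
  "borel_of X = sigma (topspace X) {U. openin X U}"

definition borel_prob_measures :: "'a topology \<Rightarrow> 'a measure set" where
  "borel_prob_measures X = {P. prob_space P \<and> sets P = sets (borel_of X)}"

definition topological_group :: "('a, 'b) monoid_scheme \<Rightarrow> 'a topology \<Rightarrow> bool" where
  "topological_group G T \<longleftrightarrow>
     group G \<and> topspace T = carrier G \<and>
     continuous_map (prod_topology T T) T (\<lambda>(x, y). x \<otimes>\<^bsub>G\<^esub> y) \<and>
     continuous_map T T (\<lambda>x. inv\<^bsub>G\<^esub> x)"

text \<open>The index set is the set of positive integers. The groups are given as a family on
  type \<^typ>\<open>nat\<close> of which only the members with positive index are ever used;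
  correspondingly, the points of the product are extensional functions on \<open>{1..}\<close>.\<close>

definition seq_topology :: "(nat \<Rightarrow> 'a topology) \<Rightarrow> (nat \<Rightarrow> 'a) topology" where
  "seq_topology T = product_topology T {1..}"

definition sigma_vars ::
    "'s set \<Rightarrow> (nat \<Rightarrow> 'a measure) \<Rightarrow> (nat \<Rightarrow> 's \<Rightarrow> 'a) \<Rightarrow> nat set \<Rightarrow> 's measure" where
  "sigma_vars \<Omega> M Y J = sigma \<Omega> (\<Union>j\<in>J. {Y j -` A \<inter> \<Omega> | A. A \<in> sets (M j)})"

definition coord :: "nat \<Rightarrow> (nat \<Rightarrow> 'a) \<Rightarrow> 'a" where
  "coord k x = x k"

definition noise ::
    "(nat \<Rightarrow> ('a, 'b) monoid_scheme) \<Rightarrow> (nat \<Rightarrow> 'a \<Rightarrow> 'a) \<Rightarrow> nat \<Rightarrow> (nat \<Rightarrow> 'a) \<Rightarrow> 'a" where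
  "noise G \<phi> k x = inv\<^bsub>G k\<^esub> (\<phi> k (coord (Suc k) x)) \<otimes>\<^bsub>G k\<^esub> coord k x"

definition future :: "(nat \<Rightarrow> 'a topology) \<Rightarrow> nat \<Rightarrow> (nat \<Rightarrow> 'a) measure" where
  "future T k = sigma_vars (topspace (seq_topology T)) (\<lambda>j. borel_of (T j)) coord {k<..}"

definition noise_future ::
    "(nat \<Rightarrow> ('a, 'b) monoid_scheme) \<Rightarrow> (nat \<Rightarrow> 'a topology) \<Rightarrow> (nat \<Rightarrow> 'a \<Rightarrow> 'a) \<Rightarrow> nat \<Rightarrow>
       (nat \<Rightarrow> 'a) measure" where
  "noise_future G T \<phi> k =
     sigma_vars (topspace (seq_topology T)) (\<lambda>j. borel_of (T j)) (noise G \<phi>) {k..}"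

definition solutions ::
    "(nat \<Rightarrow> ('a, 'b) monoid_scheme) \<Rightarrow> (nat \<Rightarrow> 'a topology) \<Rightarrow> (nat \<Rightarrow> 'a \<Rightarrow> 'a) \<Rightarrow>
       (nat \<Rightarrow> 'a measure) \<Rightarrow> (nat \<Rightarrow> 'a) measure set" where
  "solutions G T \<phi> \<mu> =
     {P \<in> borel_prob_measures (seq_topology T).
        \<forall>k\<ge>1. \<forall>f \<in> borel_measurable (borel_of (T k)). bounded (f ` topspace (T k)) \<longrightarrow>
          (AE x in P. real_cond_exp P (future T k) (\<lambda>y. f (coord k y)) x =
             (\<integral>z. f (\<phi> k (coord (Suc k) x) \<otimes>\<^bsub>G k\<^esub> z) \<partial>\<mu> k))}"

definition strong_solutions ::
    "(nat \<Rightarrow> ('a, 'b) monoid_scheme) \<Rightarrow> (nat \<Rightarrow> 'a topology) \<Rightarrow> (nat \<Rightarrow> 'a \<Rightarrow> 'a) \<Rightarrow>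
       (nat \<Rightarrow> 'a measure) \<Rightarrow> (nat \<Rightarrow> 'a) measure set" where
  "strong_solutions G T \<phi> \<mu> =
     {P \<in> solutions G T \<phi> \<mu>.
        \<forall>k\<ge>1. coord k \<in>
          sigma (space P) (sets (noise_future G T \<phi> k) \<union> null_sets P) \<rightarrow>\<^sub>M borel_of (T k)}"

text \<open>Measures do not form a real vector space as a type, so extreme points of a set of
  probability measures on a common measurable space are defined directly.\<close>

definition is_mixture :: "real \<Rightarrow> 'a measure \<Rightarrow> 'a measure \<Rightarrow> 'a measure \<Rightarrow> bool" where
  "is_mixture t Q R P \<longleftrightarrow>
     (\<forall>A\<in>sets P. measure P A = t * measure Q A + (1 - t) * measure R A)"

definition extreme_measures :: "'a measure set \<Rightarrow> 'a measure set" where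
  "extreme_measures S =
     {P \<in> S. \<forall>Q\<in>S. \<forall>R\<in>S. \<forall>t. 0 < t \<and> t < 1 \<and> is_mixture t Q R P \<longrightarrow> Q = R}"

lemma space_borel_of [simp]: "space (borel_of X) = topspace X"
  by (simp add: borel_of_def space_measure_of_conv)

lemma sets_borel_of: "sets (borel_of X) = sigma_sets (topspace X) {U. openin X U}"
  unfolding borel_of_def by (rule sets_measure_of) (auto dest: openin_subset)

lemma continuous_map_measurable:
  assumes "continuous_map X Y f"
  shows "f \<in> borel_of X \<rightarrow>\<^sub>M borel_of Y"
proof -
  have "f \<in> borel_of X \<rightarrow>\<^sub>M sigma (topspace Y) {U. openin Y U}"
  proof (rule measurable_measure_of)
    show "{U. openin Y U} \<subseteq> Pow (topspace Y)"
      by (auto dest: openin_subset)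
    show "f \<in> space (borel_of X) \<rightarrow> topspace Y"
      using assms by (auto simp: continuous_map_def)
    fix U assume "U \<in> {U. openin Y U}"
    then have "openin X {x \<in> topspace X. f x \<in> U}"
      using assms by (auto simp: continuous_map_def)
    moreover have "f -` U \<inter> space (borel_of X) = {x \<in> topspace X. f x \<in> U}"
      by auto
    ultimately show "f -` U \<inter> space (borel_of X) \<in> sets (borel_of X)"
      by (auto simp: sets_borel_of)
  qed
  then show ?thesis by (simp add: borel_of_def)
qed

text \<open>\<^const>\<open>real_cond_exp\<close> takes a junk value unless its second argument is a subalgebra.\<close>

lemma subalgebra_future:
  assumes "P \<in> borel_prob_measures (seq_topology T)"
  shows "subalgebra P (future T k)"
proof -
  let ?\<Omega> = "topspace (seq_topology T)"
  have P: "sets P = sets (borel_of (seq_topology T))"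
    using assms by (simp add: borel_prob_measures_def)
  then have sp: "space P = ?\<Omega>"
    using sets_eq_imp_space_eq[OF P] by simp
  have *: "coord j -` A \<inter> ?\<Omega> \<in> sets P" if "j > k" "A \<in> sets (borel_of (T j))" for j A
  proof -
    have "continuous_map (seq_topology T) (T j) (coord j)"
      using \<open>j > k\<close> unfolding seq_topology_def coord_def
      by (intro continuous_map_product_projection) auto
    from measurable_sets[OF continuous_map_measurable[OF this] that(2)]
    show ?thesis by (simp add: P)
  qed
  have "sets (future T k) =
      sigma_sets ?\<Omega> (\<Union>j\<in>{k<..}. {coord j -` A \<inter> ?\<Omega> | A. A \<in> sets (borel_of (T j))})"
    unfolding future_def sigma_vars_def by (rule sets_measure_of) auto
  also have "\<dots> \<subseteq> sets P"
    unfolding sp[symmetric]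
    by (rule sets.sigma_sets_subset) (use * in \<open>auto simp: sp\<close>)
  finally have "sets (future T k) \<subseteq> sets P" .
  then show ?thesis
    by (simp add: subalgebra_def sp future_def sigma_vars_def space_measure_of_conv)
qed

end

theory Submission
  imports Defs
begin

text \<open>
  Why strong solutions are extreme: every solution gives the noise \<open>(Z\<^sub>j)\<^sub>j\<close>, where
  \<open>Z\<^sub>j = \<phi>\<^sub>j(X\<^sub>j\<^sub>+\<^sub>1)\<inverse> X\<^sub>j\<close>, one and the same law, the product of the \<open>\<mu>\<^sub>j\<close>; under a strong
  solution the noise determines the whole sequence up to null sets. Let a strong solution \<open>P\<close> be
  a proper mixture of solutions \<open>Q\<close> and \<open>R\<close>. Both are absolutely continuous with respect to \<open>P\<close>.
  An arbitrary Borel set \<open>A\<close> agrees \<open>P\<close>-almost surely with some event \<open>C\<close> of the noise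
  (\<open>strong_solution_AE_eq_noise_event\<close>), hence also \<open>Q\<close>-almost surely and \<open>R\<close>-almost surely, and
  \<open>Q(A) = Q(C) = R(C) = R(A)\<close> because \<open>Q\<close> and \<open>R\<close> agree on the noise
  (\<open>solutions_agree_on_noise\<close>).

  The law of the noise is found from the bottom index up: \<open>Z\<^sub>k\<close> has law \<open>\<mu>\<^sub>k\<close> and is independent
  of \<open>(X\<^sub>j)\<^sub>j\<^sub>>\<^sub>k\<close>, which determines all later \<open>Z\<^sub>j\<close> (\<open>emeasure_noise_indep_future\<close>). The
  stochastic equation speaks of \<open>X\<^sub>k\<close> only, whereas \<open>Z\<^sub>k\<close> depends on \<open>X\<^sub>k\<close> and \<open>X\<^sub>k\<^sub>+\<^sub>1\<close> jointly.
  A monotone class argument (\<open>emeasure_joint_law\<close>) bridges this: on any event of the future,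
  \<open>(X\<^sub>k, X\<^sub>k\<^sub>+\<^sub>1)\<close> is distributed like \<open>(\<phi>\<^sub>k(X\<^sub>k\<^sub>+\<^sub>1) z, X\<^sub>k\<^sub>+\<^sub>1)\<close> with \<open>z\<close> an independent variable of
  law \<open>\<mu>\<^sub>k\<close>, and the increment of the latter pair is \<open>z\<close>.

  Countable bases enter through measurability: they make the Borel sigma-algebra of a countable
  product coincide with the one generated by the coordinates. So the group operations are jointly
  measurable, and measurability of each \<open>X\<^sub>k\<close> with respect to the completed noise sigma-algebra
  extends to all Borel sets of the product.
\<close>

section \<open>Borel sets of countable products\<close>

text \<open>With a countable subbase every open set is a countable union of finite intersections of
  subbasic sets, so a sigma-algebra containing the subbase contains all Borel sets.\<close>

lemma sets_borel_of_subset_countable_subbase: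
  assumes "countable C" "C \<subseteq> sets N" "space N = topspace X"
    and base: "\<And>U x. openin X U \<Longrightarrow> x \<in> U \<Longrightarrow> \<exists>S\<subseteq>C. finite S \<and> x \<in> \<Inter>S \<and> topspace X \<inter> \<Inter>S \<subseteq> U"
  shows "sets (borel_of X) \<subseteq> sets N"
proof -
  define D where "D = (\<lambda>S. topspace X \<inter> \<Inter>S) ` {S. finite S \<and> S \<subseteq> C}"
  have "countable D"
    unfolding D_def using assms(1) by (intro countable_image countable_Collect_finite_subset)
  have "topspace X \<inter> \<Inter>S \<in> sets N" if "finite S" "S \<subseteq> C" for S
    using that
  proof (induction S rule: finite_induct)
    case empty
    then show ?case using sets.top[of N] by (simp add: assms(3))
  next
    case (insert c S)
    then have "c \<in> sets N" "topspace X \<inter> \<Inter>S \<in> sets N"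
      using assms(2) by auto
    then have "c \<inter> (topspace X \<inter> \<Inter>S) \<in> sets N"
      by (rule sets.Int)
    then show ?case by (simp add: Int_left_commute)
  qed
  then have D: "D \<subseteq> sets N" by (auto simp: D_def)
  have "U \<in> sets N" if U: "openin X U" for U
  proof -
    have "U = \<Union>{d\<in>D. d \<subseteq> U}"
    proof
      show "U \<subseteq> \<Union>{d\<in>D. d \<subseteq> U}"
      proof
        fix x assume "x \<in> U"
        from base[OF U this] obtain S
          where "S \<subseteq> C" "finite S" "x \<in> \<Inter>S" "topspace X \<inter> \<Inter>S \<subseteq> U" by blast
        moreover have "x \<in> topspace X" using \<open>x \<in> U\<close> openin_subset[OF U] by blast
        ultimately show "x \<in> \<Union>{d\<in>D. d \<subseteq> U}" unfolding D_def by blast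
      qed
    qed auto
    also have "\<dots> \<in> sets N"
      using D \<open>countable D\<close> by (intro sets.countable_Union) (auto intro: countable_subset)
    finally show ?thesis .
  qed
  then show ?thesis
    unfolding sets_borel_of assms(3)[symmetric] by (intro sets.sigma_sets_subset) auto
qed

lemma sets_borel_of_prod_topology_subset:
  assumes "second_countable X" "second_countable Y"
  shows "sets (borel_of (prod_topology X Y)) \<subseteq> sets (borel_of X \<Otimes>\<^sub>M borel_of Y)"
proof -
  obtain A where A: "countable A" "\<And>V. V \<in> A \<Longrightarrow> openin X V"
    "\<And>U x. openin X U \<Longrightarrow> x \<in> U \<Longrightarrow> \<exists>V\<in>A. x \<in> V \<and> V \<subseteq> U"
    using assms(1) unfolding second_countable_def by metis
  obtain B where B: "countable B" "\<And>V. V \<in> B \<Longrightarrow> openin Y V"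
    "\<And>U x. openin Y U \<Longrightarrow> x \<in> U \<Longrightarrow> \<exists>V\<in>B. x \<in> V \<and> V \<subseteq> U"
    using assms(2) unfolding second_countable_def by metis
  show ?thesis
  proof (rule sets_borel_of_subset_countable_subbase)
    let ?C = "(\<lambda>(a, b). a \<times> b) ` (A \<times> B)"
    show "countable ?C" using A(1) B(1) by auto
    show "?C \<subseteq> sets (borel_of X \<Otimes>\<^sub>M borel_of Y)"
      using A(2) B(2) by (auto simp: sets_borel_of intro!: pair_measureI)
    show "space (borel_of X \<Otimes>\<^sub>M borel_of Y) = topspace (prod_topology X Y)"
      by (simp add: space_pair_measure)
    fix U x assume "openin (prod_topology X Y) U" "x \<in> U"
    then obtain V W where "openin X V" "openin Y W" "fst x \<in> V" "snd x \<in> W" "V \<times> W \<subseteq> U"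
      unfolding openin_prod_topology_alt by (metis prod.collapse)
    moreover from this A(3)[of V "fst x"] B(3)[of W "snd x"] obtain a b
      where "a \<in> A" "b \<in> B" "fst x \<in> a" "snd x \<in> b" "a \<subseteq> V" "b \<subseteq> W" by blast
    ultimately show "\<exists>S\<subseteq>?C. finite S \<and> x \<in> \<Inter>S \<and> topspace (prod_topology X Y) \<inter> \<Inter>S \<subseteq> U"
      by (intro exI[of _ "{a \<times> b}"]) (auto simp: mem_Times_iff)
  qed
qed

lemma continuous_map_measurable_pair:
  assumes "second_countable X" "second_countable Y" "continuous_map (prod_topology X Y) Z f"
  shows "f \<in> borel_of X \<Otimes>\<^sub>M borel_of Y \<rightarrow>\<^sub>M borel_of Z"
  using continuous_map_measurable[OF assms(3)] sets_borel_of_prod_topology_subset[OF assms(1,2)]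
  by (auto simp: measurable_def space_pair_measure)

lemma sets_borel_of_product_topology_subset:
  assumes "countable I" and sc: "\<And>i. i \<in> I \<Longrightarrow> second_countable (X i)"
    and sp: "space N = topspace (product_topology X I)"
    and coords: "\<And>i. i \<in> I \<Longrightarrow> (\<lambda>x. x i) \<in> N \<rightarrow>\<^sub>M borel_of (X i)"
  shows "sets (borel_of (product_topology X I)) \<subseteq> sets N"
proof -
  have "\<exists>A. \<forall>i\<in>I. countable (A i) \<and> (\<forall>V\<in>A i. openin (X i) V) \<and>
      (\<forall>U x. openin (X i) U \<and> x \<in> U \<longrightarrow> (\<exists>V\<in>A i. x \<in> V \<and> V \<subseteq> U))"
    using sc unfolding second_countable_def by (intro bchoice) auto
  then obtain A where A: "\<And>i. i \<in> I \<Longrightarrow> countable (A i)"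
    "\<And>i V. i \<in> I \<Longrightarrow> V \<in> A i \<Longrightarrow> openin (X i) V"
    "\<And>i U x. i \<in> I \<Longrightarrow> openin (X i) U \<Longrightarrow> x \<in> U \<Longrightarrow> \<exists>V\<in>A i. x \<in> V \<and> V \<subseteq> U"
    by metis
  define cyl where "cyl i V = (\<lambda>x. x i) -` V \<inter> space N" for i V
  show ?thesis
  proof (rule sets_borel_of_subset_countable_subbase)
    let ?C = "\<Union>i\<in>I. cyl i ` A i"
    show "countable ?C" using assms(1) A(1) by auto
    show "?C \<subseteq> sets N"
      using A(2) coords unfolding cyl_def
      by (auto intro!: measurable_sets simp: sets_borel_of)
    show "space N = topspace (product_topology X I)" by (rule sp)
    fix U x assume U: "openin (product_topology X I) U" and x: "x \<in> U"
    then obtain W where W: "finite {i \<in> I. W i \<noteq> topspace (X i)}"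
      "\<And>i. i \<in> I \<Longrightarrow> openin (X i) (W i)" "x \<in> Pi\<^sub>E I W" "Pi\<^sub>E I W \<subseteq> U"
      unfolding openin_product_topology_alt by meson
    define K where "K = {i \<in> I. W i \<noteq> topspace (X i)}"
    have "\<forall>i\<in>K. \<exists>V\<in>A i. x i \<in> V \<and> V \<subseteq> W i"
      using W(2,3) A(3) by (auto simp: K_def PiE_iff)
    then obtain V where V: "\<And>i. i \<in> K \<Longrightarrow> V i \<in> A i \<and> x i \<in> V i \<and> V i \<subseteq> W i" by metis
    have xs: "x \<in> space N" using openin_subset[OF U] x sp by auto
    show "\<exists>S\<subseteq>?C. finite S \<and> x \<in> \<Inter>S \<and> topspace (product_topology X I) \<inter> \<Inter>S \<subseteq> U"
    proof (intro exI[of _ "(\<lambda>i. cyl i (V i)) ` K"] conjI)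
      show "(\<lambda>i. cyl i (V i)) ` K \<subseteq> ?C" using V by (auto simp: K_def)
      show "finite ((\<lambda>i. cyl i (V i)) ` K)" using W(1) by (simp add: K_def)
      show "x \<in> \<Inter> ((\<lambda>i. cyl i (V i)) ` K)" using V xs by (auto simp: cyl_def)
      have *: "y \<in> Pi\<^sub>E I W" if y: "y \<in> topspace (product_topology X I)" "\<forall>i\<in>K. y \<in> cyl i (V i)" for y
      proof (rule PiE_I)
        fix i assume "i \<in> I"
        show "y i \<in> W i"
        proof (cases "i \<in> K")
          case True
          then show ?thesis using V y(2) by (auto simp: cyl_def)
        next
          case False
          then have "W i = topspace (X i)" using \<open>i \<in> I\<close> by (simp add: K_def)
          then show ?thesis using y(1) \<open>i \<in> I\<close> by (auto simp: PiE_iff)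
        qed
      qed (use y in auto)
      show "topspace (product_topology X I) \<inter> \<Inter> ((\<lambda>i. cyl i (V i)) ` K) \<subseteq> U"
      proof
        fix y assume y: "y \<in> topspace (product_topology X I) \<inter> \<Inter> ((\<lambda>i. cyl i (V i)) ` K)"
        show "y \<in> U"
          by (rule subsetD[OF W(4)], rule *) (use y in blast)+
      qed
    qed
  qed
qed

section \<open>Generated and completed sigma-algebras\<close>

lemma space_sigma_vars [simp]: "space (sigma_vars \<Omega> M Y J) = \<Omega>"
  by (simp add: sigma_vars_def space_measure_of_conv)

lemma sets_sigma_vars:
  "sets (sigma_vars \<Omega> M Y J) = sigma_sets \<Omega> (\<Union>j\<in>J. {Y j -` A \<inter> \<Omega> | A. A \<in> sets (M j)})"
  unfolding sigma_vars_def by (rule sets_measure_of) auto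

lemma measurable_sigma_vars:
  assumes "j \<in> J" "\<And>x. x \<in> \<Omega> \<Longrightarrow> Y j x \<in> space (M j)"
  shows "Y j \<in> sigma_vars \<Omega> M Y J \<rightarrow>\<^sub>M M j"
  using assms by (intro measurableI) (auto simp: sets_sigma_vars intro!: sigma_sets.Basic)

lemma sets_sigma_vars_subset:
  assumes "space N = \<Omega>" "\<And>j. j \<in> J \<Longrightarrow> Y j \<in> N \<rightarrow>\<^sub>M M j"
  shows "sets (sigma_vars \<Omega> M Y J) \<subseteq> sets N"
  unfolding sets_sigma_vars assms(1)[symmetric]
  by (intro sets.sigma_sets_subset) (use assms(2) in \<open>auto intro: measurable_sets\<close>)

text \<open>Completion adds nothing up to null sets: agreement almost everywhere with a member of \<open>N\<close>
  is preserved by complements and countable unions.\<close>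

lemma sigma_null_sets_AE_eq:
  assumes sub: "subalgebra P N" and A: "A \<in> sigma_sets (space P) (sets N \<union> null_sets P)"
  shows "\<exists>B\<in>sets N. AE x in P. x \<in> A \<longleftrightarrow> x \<in> B"
  using A
proof induction
  case (Basic A)
  then show ?case
  proof
    assume "A \<in> null_sets P"
    then have "AE x in P. x \<in> A \<longleftrightarrow> x \<in> {}" using AE_not_in by auto
    then show ?thesis by blast
  qed auto
next
  case Empty
  show ?case by (intro bexI[of _ "{}"]) auto
next
  case (Compl A)
  then obtain B where B: "B \<in> sets N" "AE x in P. x \<in> A \<longleftrightarrow> x \<in> B" by blast
  have "AE x in P. x \<in> space P - A \<longleftrightarrow> x \<in> space N - B"
    using B(2) sub by (auto simp: subalgebra_def)
  then show ?case using B(1) by blast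
next
  case (Union A)
  then obtain B where B: "\<And>i::nat. B i \<in> sets N" "\<And>i. AE x in P. x \<in> A i \<longleftrightarrow> x \<in> B i" by metis
  have "AE x in P. \<forall>i. x \<in> A i \<longleftrightarrow> x \<in> B i" using B(2) by (simp add: AE_all_countable)
  then have "AE x in P. x \<in> (\<Union>i. A i) \<longleftrightarrow> x \<in> (\<Union>i. B i)" by eventually_elim auto
  then show ?case using B(1) by blast
qed

section \<open>From conditional laws to joint laws\<close>

text \<open>If, on every event \<open>Y \<in> C\<close>, the variable \<open>X\<close> is distributed like \<open>g(Y, z)\<close> with \<open>z\<close>
  independent of law \<open>L\<close>, then \<open>(X, Y)\<close> is distributed like \<open>(g(Y, z), Y)\<close>: both laws are finite
  and agree on the intersection-stable generator of measurable rectangles.\<close>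

lemma emeasure_joint_law:
  assumes "finite_measure N" "finite_measure L"
    and X [measurable]: "X \<in> N \<rightarrow>\<^sub>M E" and Y [measurable]: "Y \<in> N \<rightarrow>\<^sub>M S"
    and g [measurable]: "g \<in> S \<Otimes>\<^sub>M L \<rightarrow>\<^sub>M E"
    and rect: "\<And>B C. B \<in> sets E \<Longrightarrow> C \<in> sets S \<Longrightarrow>
      emeasure N {x \<in> space N. X x \<in> B \<and> Y x \<in> C} =
      (\<integral>\<^sup>+x. emeasure L {z \<in> space L. g (Y x, z) \<in> B} * indicator C (Y x) \<partial>N)"
    and H [measurable]: "H \<in> sets (E \<Otimes>\<^sub>M S)"
  shows "emeasure N {x \<in> space N. (X x, Y x) \<in> H} =
    (\<integral>\<^sup>+x. emeasure L {z \<in> space L. (g (Y x, z), Y x) \<in> H} \<partial>N)"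
proof -
  interpret N: finite_measure N by fact
  interpret L: finite_measure L by fact
  let ?h = "\<lambda>(x, z). (g (Y x, z), Y x)"
  \<comment> \<open>the law of \<open>(X, Y)\<close> and that of \<open>(g(Y, z), Y)\<close>\<close>
  define M1 where "M1 = distr N (E \<Otimes>\<^sub>M S) (\<lambda>x. (X x, Y x))"
  define M2 where "M2 = distr (N \<Otimes>\<^sub>M L) (E \<Otimes>\<^sub>M S) ?h"
  have M1: "emeasure M1 K = emeasure N {x \<in> space N. (X x, Y x) \<in> K}"
    if [measurable]: "K \<in> sets (E \<Otimes>\<^sub>M S)" for K
    unfolding M1_def by (subst emeasure_distr) (auto intro!: arg_cong[where f="emeasure N"])
  have M2: "emeasure M2 K = (\<integral>\<^sup>+x. emeasure L {z \<in> space L. (g (Y x, z), Y x) \<in> K} \<partial>N)"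
    if [measurable]: "K \<in> sets (E \<Otimes>\<^sub>M S)" for K
  proof -
    have "emeasure M2 K = emeasure (N \<Otimes>\<^sub>M L) (?h -` K \<inter> space (N \<Otimes>\<^sub>M L))"
      unfolding M2_def by (subst emeasure_distr) auto
    also have "\<dots> = (\<integral>\<^sup>+x. emeasure L (Pair x -` (?h -` K \<inter> space (N \<Otimes>\<^sub>M L))) \<partial>N)"
      by (rule L.emeasure_pair_measure_alt) measurable
    also have "\<dots> = (\<integral>\<^sup>+x. emeasure L {z \<in> space L. (g (Y x, z), Y x) \<in> K} \<partial>N)"
      by (intro nn_integral_cong arg_cong[where f="emeasure L"]) (auto simp: space_pair_measure)
    finally show ?thesis .
  qed
  have "M1 = M2"
  proof (rule measure_eqI_generator_eq[OF Int_stable_pair_measure_generator[of E S] pair_measure_closed])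
    fix K assume "K \<in> {a \<times> b |a b. a \<in> sets E \<and> b \<in> sets S}"
    then obtain B C where K: "K = B \<times> C" and [measurable]: "B \<in> sets E" "C \<in> sets S" by auto
    have "emeasure M1 K = (\<integral>\<^sup>+x. emeasure L {z \<in> space L. g (Y x, z) \<in> B} * indicator C (Y x) \<partial>N)"
      by (subst M1) (auto simp: K rect)
    also have "\<dots> = emeasure M2 K"
      by (subst M2) (auto simp: K indicator_def intro!: nn_integral_cong)
    finally show "emeasure M1 K = emeasure M2 K" .
  next
    show "range (\<lambda>_::nat. space E \<times> space S) \<subseteq> {a \<times> b |a b. a \<in> sets E \<and> b \<in> sets S}" by blast
    show "(\<Union>i::nat. space E \<times> space S) = space E \<times> space S" by simp
    show "emeasure M1 (space E \<times> space S) \<noteq> \<infinity>" for i :: nat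
      by (subst M1) auto
  qed (auto simp: M1_def M2_def sets_pair_measure)
  then show ?thesis using M1[OF H] M2[OF H] by simp
qed

section \<open>The law of the noise under a solution\<close>

locale stochastic_equation =
  fixes G :: "nat \<Rightarrow> ('a, 'b) monoid_scheme"
    and T :: "nat \<Rightarrow> 'a topology"
    and \<phi> :: "nat \<Rightarrow> 'a \<Rightarrow> 'a"
    and \<mu> :: "nat \<Rightarrow> 'a measure"
  assumes top_group: "\<And>k. k \<ge> 1 \<Longrightarrow> topological_group (G k) (T k)"
    and second_countable: "\<And>k. k \<ge> 1 \<Longrightarrow> second_countable (T k)"
    and continuous: "\<And>k. k \<ge> 1 \<Longrightarrow> continuous_map (T (Suc k)) (T k) (\<phi> k)"
    and noise_law: "\<And>k. k \<ge> 1 \<Longrightarrow> \<mu> k \<in> borel_prob_measures (T k)"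
begin

abbreviation \<Omega> :: "(nat \<Rightarrow> 'a) set" where
  "\<Omega> \<equiv> topspace (seq_topology T)"

abbreviation B :: "nat \<Rightarrow> 'a measure" where
  "B k \<equiv> borel_of (T k)"

lemma coord_in_topspace: "x \<in> \<Omega> \<Longrightarrow> k \<ge> 1 \<Longrightarrow> coord k x \<in> topspace (T k)"
  by (auto simp: seq_topology_def coord_def PiE_iff)

lemma
  assumes "k \<ge> 1"
  shows group_G: "group (G k)" and topspace_T: "topspace (T k) = carrier (G k)"
    and \<phi>_in_carrier: "y \<in> topspace (T (Suc k)) \<Longrightarrow> \<phi> k y \<in> carrier (G k)"
    and sets_\<mu>: "sets (\<mu> k) = sets (B k)" and space_\<mu>: "space (\<mu> k) = topspace (T k)"
    and prob_\<mu>: "prob_space (\<mu> k)"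
proof -
  show "group (G k)" and *: "topspace (T k) = carrier (G k)"
    using top_group[OF assms] by (auto simp: topological_group_def)
  show "y \<in> topspace (T (Suc k)) \<Longrightarrow> \<phi> k y \<in> carrier (G k)"
    using continuous[OF assms] * by (auto simp: continuous_map_def)
  show s: "sets (\<mu> k) = sets (B k)" and "prob_space (\<mu> k)"
    using noise_law[OF assms] by (auto simp: borel_prob_measures_def)
  show "space (\<mu> k) = topspace (T k)"
    using sets_eq_imp_space_eq[OF s] by simp
qed

lemma measurable_act:
  assumes "k \<ge> 1"
  shows "(\<lambda>(y, z). \<phi> k y \<otimes>\<^bsub>G k\<^esub> z) \<in> B (Suc k) \<Otimes>\<^sub>M B k \<rightarrow>\<^sub>M B k"
proof (rule continuous_map_measurable_pair)
  have mult: "continuous_map (prod_topology (T k) (T k)) (T k) (\<lambda>(x, y). x \<otimes>\<^bsub>G k\<^esub> y)"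
    using top_group[OF assms] by (simp add: topological_group_def)
  have "continuous_map (prod_topology (T (Suc k)) (T k)) (prod_topology (T k) (T k))
      (\<lambda>p. (\<phi> k (fst p), snd p))"
    using continuous_map_compose[OF continuous_map_fst continuous[OF assms]]
    by (intro continuous_map_pairedI continuous_map_snd) (simp add: comp_def)
  from continuous_map_compose[OF this mult]
  show "continuous_map (prod_topology (T (Suc k)) (T k)) (T k) (\<lambda>(y, z). \<phi> k y \<otimes>\<^bsub>G k\<^esub> z)"
    by (simp add: comp_def case_prod_unfold)
qed (use assms second_countable in auto)

lemma measurable_increment:
  assumes "k \<ge> 1"
  shows "(\<lambda>(x, y). inv\<^bsub>G k\<^esub> (\<phi> k y) \<otimes>\<^bsub>G k\<^esub> x) \<in> B k \<Otimes>\<^sub>M B (Suc k) \<rightarrow>\<^sub>M B k"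
proof (rule continuous_map_measurable_pair)
  have mult: "continuous_map (prod_topology (T k) (T k)) (T k) (\<lambda>(x, y). x \<otimes>\<^bsub>G k\<^esub> y)"
    and inv: "continuous_map (T k) (T k) (\<lambda>x. inv\<^bsub>G k\<^esub> x)"
    using top_group[OF assms] by (simp_all add: topological_group_def)
  have "continuous_map (prod_topology (T k) (T (Suc k))) (T k) (\<lambda>p. inv\<^bsub>G k\<^esub> (\<phi> k (snd p)))"
    using continuous_map_compose[OF continuous_map_compose[OF continuous_map_snd continuous[OF assms]] inv]
    by (simp add: comp_def)
  then have "continuous_map (prod_topology (T k) (T (Suc k))) (prod_topology (T k) (T k))
      (\<lambda>p. (inv\<^bsub>G k\<^esub> (\<phi> k (snd p)), fst p))"
    by (intro continuous_map_pairedI continuous_map_fst)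
  from continuous_map_compose[OF this mult]
  show "continuous_map (prod_topology (T k) (T (Suc k))) (T k)
      (\<lambda>(x, y). inv\<^bsub>G k\<^esub> (\<phi> k y) \<otimes>\<^bsub>G k\<^esub> x)"
    by (simp add: comp_def case_prod_unfold)
qed (use assms second_countable in auto)

lemma measurable_noise:
  assumes "k \<ge> 1" "coord k \<in> N \<rightarrow>\<^sub>M B k" "coord (Suc k) \<in> N \<rightarrow>\<^sub>M B (Suc k)"
  shows "noise G \<phi> k \<in> N \<rightarrow>\<^sub>M B k"
  using measurable_compose[OF measurable_Pair[OF assms(2,3)] measurable_increment[OF assms(1)]]
  by (simp add: noise_def[abs_def])

lemma measurable_coord_future: "k < j \<Longrightarrow> coord j \<in> future T k \<rightarrow>\<^sub>M B j"
  unfolding future_def by (rule measurable_sigma_vars) (auto simp: coord_in_topspace)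

lemma space_future [simp]: "space (future T k) = \<Omega>"
  by (simp add: future_def)

lemma measurable_noise_future: "k < j \<Longrightarrow> noise G \<phi> j \<in> future T k \<rightarrow>\<^sub>M B j"
  by (intro measurable_noise measurable_coord_future) auto

lemma
  assumes "Q \<in> solutions G T \<phi> \<mu>"
  shows prob_solution: "prob_space Q"
    and sets_solution: "sets Q = sets (borel_of (seq_topology T))"
    and space_solution: "space Q = \<Omega>"
    and subalgebra_solution: "subalgebra Q (future T k)"
    and measurable_coord_solution: "j \<ge> 1 \<Longrightarrow> coord j \<in> Q \<rightarrow>\<^sub>M B j"
    and measurable_noise_solution: "j \<ge> 1 \<Longrightarrow> noise G \<phi> j \<in> Q \<rightarrow>\<^sub>M B j"
proof -
  show "prob_space Q" and s: "sets Q = sets (borel_of (seq_topology T))"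
    and "subalgebra Q (future T k)"
    using assms subalgebra_future by (auto simp: solutions_def borel_prob_measures_def)
  show "space Q = \<Omega>" using sets_eq_imp_space_eq[OF s] by simp
  have coord: "coord j \<in> Q \<rightarrow>\<^sub>M B j" if "j \<ge> 1" for j
    using that continuous_map_measurable[of "seq_topology T" "T j" "coord j"]
      continuous_map_product_coordinates[of j "{1..}" T]
    by (simp add: measurable_cong_sets[OF s refl] coord_def[abs_def] seq_topology_def)
  show "j \<ge> 1 \<Longrightarrow> coord j \<in> Q \<rightarrow>\<^sub>M B j" by (rule coord)
  show "j \<ge> 1 \<Longrightarrow> noise G \<phi> j \<in> Q \<rightarrow>\<^sub>M B j"
    by (intro measurable_noise coord) auto
qed

lemma measurable_transition:
  assumes Q: "Q \<in> solutions G T \<phi> \<mu>" and k: "k \<ge> 1" and A [measurable]: "A \<in> sets (B k)"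
  shows "(\<lambda>x. emeasure (\<mu> k) {z \<in> space (\<mu> k). \<phi> k (coord (Suc k) x) \<otimes>\<^bsub>G k\<^esub> z \<in> A})
    \<in> borel_measurable Q"
proof -
  interpret L: prob_space "\<mu> k" using k by (rule prob_\<mu>)
  note [measurable] = measurable_coord_solution[OF Q, of "Suc k"]
  have [measurable_cong]: "sets (\<mu> k) = sets (B k)" using k by (rule sets_\<mu>)
  have act [measurable]: "(\<lambda>(y, z). \<phi> k y \<otimes>\<^bsub>G k\<^esub> z) \<in> B (Suc k) \<Otimes>\<^sub>M \<mu> k \<rightarrow>\<^sub>M B k"
    using measurable_act[OF k] by measurable
  let ?H = "{p \<in> space (Q \<Otimes>\<^sub>M \<mu> k). \<phi> k (coord (Suc k) (fst p)) \<otimes>\<^bsub>G k\<^esub> snd p \<in> A}"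
  have "?H \<in> sets (Q \<Otimes>\<^sub>M \<mu> k)"
    using measurable_compose[OF _ act, of "\<lambda>p. (coord (Suc k) (fst p), snd p)" "Q \<Otimes>\<^sub>M \<mu> k"]
    by measurable
  then have "(\<lambda>x. emeasure (\<mu> k) (Pair x -` ?H)) \<in> borel_measurable Q"
    by (rule L.measurable_emeasure_Pair)
  moreover have "Pair x -` ?H = {z \<in> space (\<mu> k). \<phi> k (coord (Suc k) x) \<otimes>\<^bsub>G k\<^esub> z \<in> A}"
    if "x \<in> space Q" for x
    using that by (auto simp: space_pair_measure)
  ultimately show ?thesis by (simp cong: measurable_cong)
qed

text \<open>The stochastic equation in integrated form, obtained by testing the conditional expectation
  of the indicator of \<open>A\<close> against an event \<open>F\<close> of the future.\<close>

lemma emeasure_coord_given_future: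
  assumes Q: "Q \<in> solutions G T \<phi> \<mu>" and k: "k \<ge> 1"
    and F: "F \<in> sets (future T k)" and A [measurable]: "A \<in> sets (B k)"
  shows "emeasure Q {x \<in> F. coord k x \<in> A} =
    (\<integral>\<^sup>+x. emeasure (\<mu> k) {z \<in> space (\<mu> k). \<phi> k (coord (Suc k) x) \<otimes>\<^bsub>G k\<^esub> z \<in> A} *
      indicator F x \<partial>Q)"
proof -
  interpret Q: prob_space Q using Q by (rule prob_solution)
  interpret L: prob_space "\<mu> k" using k by (rule prob_\<mu>)
  interpret S: finite_measure_subalgebra Q "future T k"
    using subalgebra_solution[OF Q] by unfold_locales
  note [measurable] = measurable_coord_solution[OF Q k] measurable_coord_solution[OF Q, of "Suc k"]
  have [measurable_cong]: "sets (\<mu> k) = sets (B k)" using k by (rule sets_\<mu>)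
  have [measurable]: "F \<in> sets Q" using F subalgebra_solution[OF Q] by (auto simp: subalgebra_def)
  define c where "c x = measure (\<mu> k) {z \<in> space (\<mu> k). \<phi> k (coord (Suc k) x) \<otimes>\<^bsub>G k\<^esub> z \<in> A}" for x
  have c [measurable]: "c \<in> borel_measurable Q"
    using measurable_transition[OF Q k A] unfolding c_def measure_def by measurable
  have cond: "AE x in Q. real_cond_exp Q (future T k) (\<lambda>y. indicator A (coord k y)) x = c x"
  proof -
    have "AE x in Q. real_cond_exp Q (future T k) (\<lambda>y. indicat_real A (coord k y)) x =
        (\<integral>z. indicat_real A (\<phi> k (coord (Suc k) x) \<otimes>\<^bsub>G k\<^esub> z) \<partial>\<mu> k)"
    proof -
      have "bounded (indicat_real A ` topspace (T k))"
        by (rule boundedI[of _ 1]) (auto simp: indicator_def)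
      then show ?thesis
        using Q k borel_measurable_indicator[OF A, where ?'b = real] by (auto simp: solutions_def)
    qed
    moreover have "(\<integral>z. indicat_real A (\<phi> k (coord (Suc k) x) \<otimes>\<^bsub>G k\<^esub> z) \<partial>\<mu> k) = c x"
      if "x \<in> space Q" for x
    proof -
      have "(\<integral>z. indicat_real A (\<phi> k (coord (Suc k) x) \<otimes>\<^bsub>G k\<^esub> z) \<partial>\<mu> k) =
        (\<integral>z. indicat_real {z \<in> space (\<mu> k). \<phi> k (coord (Suc k) x) \<otimes>\<^bsub>G k\<^esub> z \<in> A} z \<partial>\<mu> k)"
        by (intro Bochner_Integration.integral_cong) (auto simp: indicator_def)
      also have "\<dots> = c x"
        unfolding c_def by (simp, intro arg_cong[where f="measure (\<mu> k)"]) auto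
      finally show ?thesis .
    qed
    ultimately show ?thesis using AE_space by (auto elim: AE_mp)
  qed
  have "measure Q {x \<in> F. coord k x \<in> A} = (\<integral>x. indicator F x * indicator A (coord k x) \<partial>Q)"
  proof -
    have "(\<integral>x. indicator F x * indicator A (coord k x) \<partial>Q) = (\<integral>x. indicat_real {x \<in> F. coord k x \<in> A} x \<partial>Q)"
      by (intro Bochner_Integration.integral_cong) (auto simp: indicator_def)
    also have "\<dots> = measure Q {x \<in> F. coord k x \<in> A}"
      using sets.sets_into_space[OF \<open>F \<in> sets Q\<close>] by (simp add: Int_absorb2 subset_eq)
    finally show ?thesis by simp
  qed
  also have "\<dots> = (\<integral>x. indicator F x * real_cond_exp Q (future T k) (\<lambda>y. indicator A (coord k y)) x \<partial>Q)"
    using S.real_cond_exp_intA[OF _ F, of "\<lambda>y. indicator A (coord k y)"]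
    by (simp add: set_lebesgue_integral_def Q.integrable_const_bound[where B=1])
  also have "\<dots> = (\<integral>x. c x * indicator F x \<partial>Q)"
    by (intro integral_cong_AE) (use cond in \<open>auto simp: mult.commute\<close>)
  finally have eq: "measure Q {x \<in> F. coord k x \<in> A} = (\<integral>x. c x * indicator F x \<partial>Q)" .
  have "integrable Q (\<lambda>x. c x * indicator F x)"
  proof (rule Q.integrable_const_bound[where B=1])
    show "AE x in Q. norm (c x * indicator F x) \<le> 1" by (auto simp: c_def indicator_def)
  qed measurable
  then have "(\<integral>\<^sup>+x. ennreal (c x * indicator F x) \<partial>Q) = ennreal (\<integral>x. c x * indicator F x \<partial>Q)"
    by (rule nn_integral_eq_integral) (auto simp: c_def)
  moreover have "ennreal (c x * indicator F x) =
      emeasure (\<mu> k) {z \<in> space (\<mu> k). \<phi> k (coord (Suc k) x) \<otimes>\<^bsub>G k\<^esub> z \<in> A} * indicator F x" for x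
    by (auto simp: c_def L.emeasure_eq_measure indicator_def)
  ultimately show ?thesis
    by (simp add: Q.emeasure_eq_measure eq)
qed

text \<open>Apply the joint law of \<open>(X\<^sub>k, X\<^sub>k\<^sub>+\<^sub>1)\<close>, on the part \<open>F\<close> of the space, to the set of pairs
  \<open>(x, y)\<close> with \<open>\<phi>\<^sub>k(y)\<inverse> x \<in> A\<close>. For \<open>x = \<phi>\<^sub>k(y) z\<close> this condition reads \<open>z \<in> A\<close> whatever \<open>y\<close> is,
  so the inner integral is the constant \<open>\<mu>\<^sub>k(A)\<close>.\<close>

lemma emeasure_noise_indep_future:
  assumes Q: "Q \<in> solutions G T \<phi> \<mu>" and k: "k \<ge> 1"
    and F: "F \<in> sets (future T k)" and A [measurable]: "A \<in> sets (B k)"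
  shows "emeasure Q {x \<in> F. noise G \<phi> k x \<in> A} = emeasure (\<mu> k) A * emeasure Q F"
proof -
  interpret Q: prob_space Q using Q by (rule prob_solution)
  interpret L: prob_space "\<mu> k" using k by (rule prob_\<mu>)
  interpret group "G k" using k by (rule group_G)
  have [measurable]: "F \<in> sets Q" using F subalgebra_solution[OF Q] by (auto simp: subalgebra_def)
  have FQ: "F \<subseteq> space Q" by (rule sets.sets_into_space) measurable
  have coord_future: "coord (Suc k) \<in> future T k \<rightarrow>\<^sub>M B (Suc k)"
    by (rule measurable_coord_future) simp
  note [measurable] = measurable_coord_solution[OF Q k] measurable_coord_solution[OF Q, of "Suc k"]
  have [measurable_cong]: "sets (\<mu> k) = sets (B k)" using k by (rule sets_\<mu>)
  have A_space: "A \<subseteq> topspace (T k)" using sets.sets_into_space[OF A] by simp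
  \<comment> \<open>\<open>N\<close> is \<open>Q\<close> restricted to \<open>F\<close>, kept on the whole space so that the coordinates stay measurable\<close>
  define N where "N = density Q (indicator F)"
  have N: "emeasure N D = emeasure Q (F \<inter> D)" if "D \<in> sets Q" for D
    unfolding N_def using that by (intro emeasure_restricted) auto
  have [simp]: "space N = space Q" and [measurable_cong]: "sets N = sets Q"
    by (simp_all add: N_def)
  have N_int: "(\<integral>\<^sup>+x. f x \<partial>N) = (\<integral>\<^sup>+x. indicator F x * f x \<partial>Q)" if "f \<in> borel_measurable Q" for f
    unfolding N_def using that by (intro nn_integral_density) auto
  let ?g = "\<lambda>(y, z). \<phi> k y \<otimes>\<^bsub>G k\<^esub> z"
  let ?H = "{p \<in> space (B k \<Otimes>\<^sub>M B (Suc k)). inv\<^bsub>G k\<^esub> (\<phi> k (snd p)) \<otimes>\<^bsub>G k\<^esub> fst p \<in> A}"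
  have H: "?H \<in> sets (B k \<Otimes>\<^sub>M B (Suc k))"
    using measurable_sets[OF measurable_increment[OF k] A]
    by (simp add: vimage_def Int_def case_prod_unfold conj_commute)
  have "emeasure Q {x \<in> F. noise G \<phi> k x \<in> A} = emeasure N {x \<in> space N. (coord k x, coord (Suc k) x) \<in> ?H}"
  proof -
    have "(\<lambda>x. (coord k x, coord (Suc k) x)) -` ?H \<inter> space Q \<in> sets Q"
      by (rule measurable_sets[OF _ H]) measurable
    moreover have "(\<lambda>x. (coord k x, coord (Suc k) x)) -` ?H \<inter> space Q =
        {x \<in> space N. (coord k x, coord (Suc k) x) \<in> ?H}"
      by auto
    ultimately have "{x \<in> space N. (coord k x, coord (Suc k) x) \<in> ?H} \<in> sets Q"
      by (simp only:)
    moreover have "F \<inter> {x \<in> space N. (coord k x, coord (Suc k) x) \<in> ?H} = {x \<in> F. noise G \<phi> k x \<in> A}"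
      using FQ k by (auto simp: noise_def space_pair_measure space_solution[OF Q] coord_in_topspace)
    ultimately show ?thesis by (simp add: N)
  qed
  also have "\<dots> = (\<integral>\<^sup>+x. emeasure (\<mu> k) {z \<in> space (\<mu> k). (?g (coord (Suc k) x, z), coord (Suc k) x) \<in> ?H} \<partial>N)"
  proof (rule emeasure_joint_law[where E = "B k" and S = "B (Suc k)"])
    show "finite_measure N"
      by (rule finite_measureI) (simp add: N)
    show "finite_measure (\<mu> k)" by unfold_locales
    show "?g \<in> B (Suc k) \<Otimes>\<^sub>M \<mu> k \<rightarrow>\<^sub>M B k" using measurable_act[OF k] by measurable
    show "?H \<in> sets (B k \<Otimes>\<^sub>M B (Suc k))" by (rule H)
    fix D C assume [measurable]: "D \<in> sets (B k)" "C \<in> sets (B (Suc k))"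
    \<comment> \<open>the constraint on \<open>X\<^sub>k\<^sub>+\<^sub>1\<close> is itself an event of the future and can be absorbed into \<open>F\<close>\<close>
    define F' where "F' = F \<inter> (coord (Suc k) -` C \<inter> space (future T k))"
    have F': "F' \<in> sets (future T k)"
      unfolding F'_def using F coord_future by (intro sets.Int measurable_sets) auto
    have "{x \<in> space Q. coord k x \<in> D \<and> coord (Suc k) x \<in> C} \<in> sets Q" by measurable
    from N[OF this] have "emeasure N {x \<in> space N. coord k x \<in> D \<and> coord (Suc k) x \<in> C} =
        emeasure Q (F \<inter> {x \<in> space Q. coord k x \<in> D \<and> coord (Suc k) x \<in> C})"
      by simp
    also have "\<dots> = emeasure Q {x \<in> F'. coord k x \<in> D}"
      using FQ by (auto simp: F'_def space_solution[OF Q] intro!: arg_cong[where f="emeasure Q"])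
    also have "\<dots> = (\<integral>\<^sup>+x. emeasure (\<mu> k) {z \<in> space (\<mu> k). ?g (coord (Suc k) x, z) \<in> D} * indicator F' x \<partial>Q)"
      using emeasure_coord_given_future[OF Q k F'] by simp
    also have "\<dots> = (\<integral>\<^sup>+x. emeasure (\<mu> k) {z \<in> space (\<mu> k). ?g (coord (Suc k) x, z) \<in> D} * indicator C (coord (Suc k) x) \<partial>N)"
    proof (subst N_int)
      show "(\<lambda>x. emeasure (\<mu> k) {z \<in> space (\<mu> k). ?g (coord (Suc k) x, z) \<in> D} *
          indicator C (coord (Suc k) x)) \<in> borel_measurable Q"
      proof (rule borel_measurable_times_ennreal)
        show "(\<lambda>x. emeasure (\<mu> k) {z \<in> space (\<mu> k). ?g (coord (Suc k) x, z) \<in> D}) \<in> borel_measurable Q"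
          using measurable_transition[OF Q k \<open>D \<in> sets (B k)\<close>] by simp
      qed measurable
    qed (auto simp: F'_def indicator_def space_solution[OF Q] intro!: nn_integral_cong)
    finally show "emeasure N {x \<in> space N. coord k x \<in> D \<and> coord (Suc k) x \<in> C} =
      (\<integral>\<^sup>+x. emeasure (\<mu> k) {z \<in> space (\<mu> k). ?g (coord (Suc k) x, z) \<in> D} * indicator C (coord (Suc k) x) \<partial>N)" .
  qed measurable
  also have "\<dots> = (\<integral>\<^sup>+x. emeasure (\<mu> k) A \<partial>N)"
  proof (intro nn_integral_cong arg_cong[where f="emeasure (\<mu> k)"])
    fix x assume "x \<in> space N"
    then have y: "coord (Suc k) x \<in> topspace (T (Suc k))"
      using Q by (simp add: space_solution coord_in_topspace)
    from \<phi>_in_carrier[OF k this] y A_space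
    show "{z \<in> space (\<mu> k). (?g (coord (Suc k) x, z), coord (Suc k) x) \<in> ?H} = A"
      by (auto simp: space_\<mu>[OF k] space_pair_measure topspace_T[OF k] m_assoc[symmetric])
  qed
  also have "\<dots> = emeasure (\<mu> k) A * emeasure Q F"
    using FQ by (simp add: N Int_absorb2)
  finally show ?thesis .
qed

text \<open>Independence of the noise: the smallest index \<open>k\<close> is split off, since the constraints at all
  larger indices form an event of the future of \<open>k\<close>.\<close>

lemma emeasure_noise_cylinder:
  assumes Q: "Q \<in> solutions G T \<phi> \<mu>" and "finite J" "J \<subseteq> {1..}"
    and A: "\<And>j. j \<in> J \<Longrightarrow> A j \<in> sets (B j)"
  shows "emeasure Q {x \<in> \<Omega>. \<forall>j\<in>J. noise G \<phi> j x \<in> A j} = (\<Prod>j\<in>J. emeasure (\<mu> j) (A j))"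
  using assms(2-)
proof (induction J rule: finite_linorder_min_induct)
  case empty
  interpret Q: prob_space Q using Q by (rule prob_solution)
  show ?case using Q.emeasure_space_1 by (simp add: space_solution[OF Q])
next
  case (insert k J)
  let ?F = "{x \<in> \<Omega>. \<forall>j\<in>J. noise G \<phi> j x \<in> A j}"
  have "{x \<in> space (future T k). \<forall>j\<in>J. noise G \<phi> j x \<in> A j} \<in> sets (future T k)"
  proof (rule sets.sets_Collect_finite_All)
    fix j assume "j \<in> J"
    with insert have "noise G \<phi> j \<in> future T k \<rightarrow>\<^sub>M B j" "A j \<in> sets (B j)"
      by (auto intro: measurable_noise_future)
    from measurable_sets[OF this] 
    show "{x \<in> space (future T k). noise G \<phi> j x \<in> A j} \<in> sets (future T k)"
      by (simp add: vimage_def Int_def conj_commute)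
  qed (use insert in auto)
  then have F: "?F \<in> sets (future T k)" by simp
  have "{x \<in> \<Omega>. \<forall>j\<in>insert k J. noise G \<phi> j x \<in> A j} = {x \<in> ?F. noise G \<phi> k x \<in> A k}" by auto
  moreover have "k \<notin> J" using insert.hyps by auto
  ultimately show ?case
    using emeasure_noise_indep_future[OF Q _ F] insert by simp
qed

text \<open>The noise sigma-algebra consists of the preimages under the noise sequence \<open>Z\<close> of the product
  sigma-algebra, and a law on the latter is determined by its values on cylinders.\<close>

lemma solutions_agree_on_noise:
  assumes Q: "Q \<in> solutions G T \<phi> \<mu>" and R: "R \<in> solutions G T \<phi> \<mu>"
    and A: "A \<in> sets (noise_future G T \<phi> 1)"
  shows "emeasure Q A = emeasure R A"
proof -
  let ?Z = "\<lambda>x. \<lambda>j\<in>{1..}. noise G \<phi> j x"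
  let ?M = "PiM {1..} B"
  have Z: "?Z \<in> S \<rightarrow>\<^sub>M ?M" if "S \<in> solutions G T \<phi> \<mu>" for S
    using measurable_noise_solution[OF that] by (intro measurable_restrict) auto
  have Z_space: "?Z \<in> \<Omega> \<rightarrow> space ?M"
    using measurable_space[OF Z[OF Q]] by (simp add: space_solution[OF Q])
  have noise_space: "noise G \<phi> j x \<in> topspace (T j)" if "x \<in> \<Omega>" "j \<ge> 1" for x j
    using measurable_space[OF measurable_noise_solution[OF Q that(2)], of x] that(1)
    by (simp only: space_solution[OF Q] space_borel_of)
  have cyl: "emeasure (distr S ?M ?Z) (prod_emb {1..} B J (Pi\<^sub>E J D)) = (\<Prod>j\<in>J. emeasure (\<mu> j) (D j))"
    if S: "S \<in> solutions G T \<phi> \<mu>" and J: "finite J" "J \<subseteq> {1..}" and D: "\<And>j. j \<in> J \<Longrightarrow> D j \<in> sets (B j)"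
    for S J D
  proof -
    have "?Z -` prod_emb {1..} B J (Pi\<^sub>E J D) \<inter> space S = {x \<in> \<Omega>. \<forall>j\<in>J. noise G \<phi> j x \<in> D j}"
    proof -
      have "?Z x \<in> prod_emb {1..} B J (Pi\<^sub>E J D) \<longleftrightarrow> (\<forall>j\<in>J. noise G \<phi> j x \<in> D j)" if "x \<in> \<Omega>" for x
        using J(2) noise_space that
        by (auto simp: prod_emb_def space_PiM PiE_iff extensional_def subset_eq)
      then show ?thesis by (auto simp: space_solution[OF S])
    qed
    then show ?thesis
      using emeasure_noise_cylinder[OF S J D] J D
      by (subst emeasure_distr[OF Z[OF S]]) (auto intro: sets_PiM_I)
  qed
  have law: "distr Q ?M ?Z = distr R ?M ?Z"
  proof (rule measure_eqI_PiM_infinite)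
    show "finite_measure (distr Q ?M ?Z)"
      using prob_space.prob_space_distr[OF prob_solution[OF Q] Z[OF Q]]
      by (simp add: prob_space.finite_measure prob_space_def)
    fix D J assume J: "finite J" "J \<subseteq> {1..}" "\<And>j. j \<in> J \<Longrightarrow> D j \<in> sets (B j)"
    show "emeasure (distr Q ?M ?Z) (prod_emb {1..} B J (Pi\<^sub>E J D)) =
        emeasure (distr R ?M ?Z) (prod_emb {1..} B J (Pi\<^sub>E J D))"
      by (simp only: cyl[OF Q J] cyl[OF R J])
  qed simp_all
  have "sets (noise_future G T \<phi> 1) \<subseteq> sets (vimage_algebra \<Omega> ?Z ?M)"
    unfolding noise_future_def
  proof (rule sets_sigma_vars_subset)
    fix j :: nat assume j: "j \<in> {1..}"
    show "noise G \<phi> j \<in> vimage_algebra \<Omega> ?Z ?M \<rightarrow>\<^sub>M B j"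
      using measurable_compose[OF measurable_vimage_algebra1[OF Z_space] measurable_component_singleton[OF j]] j
      by simp
  qed simp
  with A obtain D where D: "D \<in> sets ?M" "A = ?Z -` D \<inter> \<Omega>"
    unfolding sets_vimage_algebra2[OF Z_space] by blast
  have "emeasure S A = emeasure (distr S ?M ?Z) D" if "S \<in> solutions G T \<phi> \<mu>" for S
    unfolding D(2) by (subst emeasure_distr[OF Z[OF that] D(1)]) (simp only: space_solution[OF that])
  then show ?thesis using Q R law by simp
qed

section \<open>Strong solutions\<close>

lemma subalgebra_noise_future:
  assumes "Q \<in> solutions G T \<phi> \<mu>"
  shows "subalgebra Q (noise_future G T \<phi> 1)"
  unfolding subalgebra_def noise_future_def
proof
  show "sets (sigma_vars \<Omega> B (noise G \<phi>) {1..}) \<subseteq> sets Q"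
    using space_solution[OF assms] measurable_noise_solution[OF assms]
    by (rule sets_sigma_vars_subset) simp
qed (simp add: space_solution[OF assms])

text \<open>Strength makes each coordinate \<open>X\<^sub>k\<close> measurable for the completion of the noise from index
  \<open>k\<close> on, hence for that of the whole noise. Since the coordinates generate all Borel sets of the
  product, every Borel set lies in the latter completion.\<close>

lemma strong_solution_AE_eq_noise_event:
  assumes P: "P \<in> strong_solutions G T \<phi> \<mu>" and A: "A \<in> sets P"
  shows "\<exists>C\<in>sets (noise_future G T \<phi> 1). AE x in P. x \<in> A \<longleftrightarrow> x \<in> C"
proof (rule sigma_null_sets_AE_eq)
  have sol: "P \<in> solutions G T \<phi> \<mu>" using P by (simp add: strong_solutions_def)
  show sub: "subalgebra P (noise_future G T \<phi> 1)" using sol by (rule subalgebra_noise_future)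
  let ?M = "\<lambda>k. sigma (space P) (sets (noise_future G T \<phi> k) \<union> null_sets P)"
  have sub_space: "sets (noise_future G T \<phi> 1) \<union> null_sets P \<subseteq> Pow (space P)"
    using sub sets.space_closed[of P] by (auto simp: subalgebra_def)
  have mono: "sets (noise_future G T \<phi> k) \<subseteq> sets (noise_future G T \<phi> 1)" if "k \<ge> 1" for k
    unfolding noise_future_def sets_sigma_vars by (intro sigma_sets_mono' UN_mono) (use that in auto)
  have "sets (borel_of (seq_topology T)) \<subseteq> sets (?M 1)"
    unfolding seq_topology_def
  proof (rule sets_borel_of_product_topology_subset)
    fix k :: nat assume "k \<in> {1..}"
    then have k: "k \<ge> 1" by simp
    have "coord k \<in> ?M k \<rightarrow>\<^sub>M B k" using P k by (simp add: strong_solutions_def)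
    moreover have "sets (?M k) \<subseteq> sets (?M 1)"
    proof -
      have *: "sets (noise_future G T \<phi> k) \<union> null_sets P \<subseteq> sets (noise_future G T \<phi> 1) \<union> null_sets P"
        using mono[OF k] by blast
      show ?thesis
        unfolding sets_measure_of[OF sub_space] sets_measure_of[OF order_trans[OF * sub_space]]
        using * by (rule sigma_sets_mono')
    qed
    ultimately have "coord k \<in> ?M 1 \<rightarrow>\<^sub>M B k"
      unfolding measurable_def space_measure_of_conv by blast
    then show "(\<lambda>x. x k) \<in> ?M 1 \<rightarrow>\<^sub>M B k"
      by (simp only: coord_def[abs_def])
  next
    show "space (?M 1) = topspace (product_topology T {1..})"
      unfolding space_measure_of_conv space_solution[OF sol] seq_topology_def ..
  qed (use second_countable in auto)
  then show "A \<in> sigma_sets (space P) (sets (noise_future G T \<phi> 1) \<union> null_sets P)"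
    using A unfolding sets_measure_of[OF sub_space] sets_solution[OF sol] by (rule subsetD)
qed

end

theorem corollary2p7:
  fixes G :: "nat \<Rightarrow> ('a, 'b) monoid_scheme"
    and T :: "nat \<Rightarrow> 'a topology"
    and \<phi> :: "nat \<Rightarrow> 'a \<Rightarrow> 'a"
    and \<mu> :: "nat \<Rightarrow> 'a measure"
  assumes "\<And>k. k \<ge> 1 \<Longrightarrow> topological_group (G k) (T k)"
    and "\<And>k. k \<ge> 1 \<Longrightarrow> compact_space (T k)"
    and "\<And>k. k \<ge> 1 \<Longrightarrow> Hausdorff_space (T k)"
    and "\<And>k. k \<ge> 1 \<Longrightarrow> second_countable (T k)"
    and "\<And>k. k \<ge> 1 \<Longrightarrow> \<phi> k \<in> hom (G (Suc k)) (G k)"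
    and "\<And>k. k \<ge> 1 \<Longrightarrow> continuous_map (T (Suc k)) (T k) (\<phi> k)"
    and "\<And>k. k \<ge> 1 \<Longrightarrow> \<mu> k \<in> borel_prob_measures (T k)"
  shows "strong_solutions G T \<phi> \<mu> \<subseteq> extreme_measures (solutions G T \<phi> \<mu>)"
proof
  interpret stochastic_equation G T \<phi> \<mu>
    by unfold_locales (rule assms; assumption)+
  fix P assume P: "P \<in> strong_solutions G T \<phi> \<mu>"
  then have sol: "P \<in> solutions G T \<phi> \<mu>" by (simp add: strong_solutions_def)
  have "Q = R"
    if Q: "Q \<in> solutions G T \<phi> \<mu>" and R: "R \<in> solutions G T \<phi> \<mu>"
      and t: "0 < t" "t < 1" and mix: "is_mixture t Q R P" for Q R t
  proof (rule measure_eqI)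
    interpret P: prob_space P using sol by (rule prob_solution)
    interpret Q: prob_space Q using Q by (rule prob_solution)
    interpret R: prob_space R using R by (rule prob_solution)
    have sets: "sets Q = sets P" "sets R = sets P"
      using sol Q R by (simp_all add: sets_solution)
    then show "sets Q = sets R" by simp
    \<comment> \<open>both weights are positive, so null sets of the mixture are null for each component\<close>
    have null: "measure Q A = 0 \<and> measure R A = 0" if "A \<in> null_sets P" for A
    proof -
      have "t * measure Q A + (1 - t) * measure R A = 0"
        using mix null_setsD2[OF that] measure_eq_0_null_sets[OF that] by (simp add: is_mixture_def)
      moreover have "0 \<le> t * measure Q A" "0 \<le> (1 - t) * measure R A" using t by auto
      ultimately have "t * measure Q A = 0" "(1 - t) * measure R A = 0" by linarith+
      then show ?thesis using t by simp
    qed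
    have ac: "absolutely_continuous P Q" "absolutely_continuous P R"
      using null by (auto simp: absolutely_continuous_def sets null_setsD2
          Q.emeasure_eq_measure R.emeasure_eq_measure intro!: null_setsI)
    fix A assume "A \<in> sets Q"
    then have A: "A \<in> sets P" by (simp add: sets)
    obtain C where C: "C \<in> sets (noise_future G T \<phi> 1)" "AE x in P. x \<in> A \<longleftrightarrow> x \<in> C"
      using strong_solution_AE_eq_noise_event[OF P A] by blast
    have "C \<in> sets P" using C(1) subalgebra_noise_future[OF sol] by (auto simp: subalgebra_def)
    have "emeasure Q A = emeasure Q C"
      using absolutely_continuous_AE[OF sets(1) ac(1) C(2)] A \<open>C \<in> sets P\<close>
      by (intro emeasure_eq_AE) (simp_all add: sets)
    also have "\<dots> = emeasure R C" using Q R C(1) by (rule solutions_agree_on_noise)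
    also have "\<dots> = emeasure R A"
      using absolutely_continuous_AE[OF sets(2) ac(2) C(2)] A \<open>C \<in> sets P\<close>
      by (intro emeasure_eq_AE) (auto simp: sets)
    finally show "emeasure Q A = emeasure R A" .
  qed
  then show "P \<in> extreme_measures (solutions G T \<phi> \<mu>)"
    using sol unfolding extreme_measures_def by blast
qed

end
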